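(* Let $X,Y$ be finite sets, let $P(X)$ and $P(Y)$ be two regular path complexes on $X$ and $Y$, and let $P(Z)=P(X)\boxplus P(Y)$ be their Cartesian product, a path complex on $Z=X\times Y$. Then any $\partial$-invariant path $w$ on $Z$ (i.e. $w\in\Omega_r(Z)$ for some $r\ge 0$) admits a representation in the form $$w=\sum_{i=1}^k u_i\times v_i$$ for some finite $k$, where $u_i$ and $v_i$ are $\partial$-invariant paths on $X$ and $Y$, respectively.
   Context: Fix a field $\mathbb K$; all vector spaces are over $\mathbb K$. For a finite set $V$ and $p\ge 0$, an elementary $p$-path is a sequence $i_0\dots i_p$ of vertices of $V$; it is regular if $i_{k-1}\ne i_k$ for all $k$. $\mathcal R_p(V)$ is the vector space with basis $\{e_{i_0\dots i_p}: i_0\dots i_p \text{ regular}\}$; $u^{x}$ denotes the $e_x$-coefficient of $u$. The regular truncated boundary operator $\partial:\mathcal R_p(V)\to\mathcal R_{p-1}(V)$, $p\ge1$, is $\partial e_{i_0\dots i_p}=\sum_{q=0}^p(-1)^q e_{i_0\dots\widehat{i_q}\dots i_p}$, where every term with a non-regular index sequence is replaced by $0$; $\partial=0$ on $\mathcal R_0(V)$, $\mathcal R_{-1}=\{0\}$. A path complex $P(V)$ over $V$ is a non-empty collection of elementary paths (the empty path included) such that if $i_0\dots i_n\in P(V)$, $n\ge 0$, then $i_0\dots i_{n-1}$ and $i_1\dots i_n$ are in $P(V)$; the vertex set is always taken so that all vertices of $V$ are in $P(V)$. It is regular if it contains no $1$-path $ii$. Paths in $P(V)$ are called allowed. $\mathcal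 A_n(V)$ is the span of $e_x$ over allowed $n$-paths $x$ ($\mathcal A_{-1}=\{0\}$ here), and $\Omega_n(V)=\{v\in\mathcal A_n(V):\partial v\in\mathcal A_{n-1}(V)\}$ is the space of $\partial$-invariant $n$-paths. Let $Z=X\times Y$. A regular elementary path $z=z_0\dots z_r$ on $Z$, $z_k=(x_k,y_k)$, is step-like if for each $k=1,\dots,r$ either $x_{k-1}=x_k$ (vertical couple) or $y_{k-1}=y_k$ (horizontal couple). Its projection onto $X$ is obtained by taking the sequence of $X$-components and collapsing every run of repeated consecutive vertices to one vertex; similarly for $Y$. If the projections are $x_0\dots x_p$ and $y_0\dots y_q$ then $p+q=r$, and $z$ is represented by a staircase in $\mathbb Z^2$ from $(0,0)$ to $(p,q)$ (the vertex $(x_i,y_j)$ being represented by $(i,j)$). The elevation $L(z)$ is the number of unit cells in $\mathbb Z_+^2$ below this staircase, i.e. the number of pairs (vertical couple, later horizontal couple) in $z$. For $u\in\mathcal R_p(X)$, $v\in\mathcal R_q(Y)$, the cross product $u\times v\in\mathcal R_{p+q}(Z)$ is defined by $(u\times v)^z=(-1)^{L(z)}u^xv^y$ if $z$ is a step-like $(p+q)$-path with projections $x$ on $X$ and $y$ on $Y$ (with $u^x=0$ if $x$ is not a $p$-path and $v^y=0$ if $y$ is not a $q$-path), and $(u\times v)^z=0$ if $z$ is not step-like. The Cartesian product $P(X)\boxplus P(Y)$ is the path complex on $Z$ consisting of all step-like paths on $Z$ whose projections on $X$ and $Y$ belong to $P(X)$ and $P(Y)$, respectively. *)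

theory Defs
  imports Complex_Main "HOL-Library.Function_Algebras"
begin

text \<open>
  An elementary \<open>p\<close>-path \<open>i\<^sub>0 \<dots> i\<^sub>p\<close> is a list of length \<open>p + 1\<close>, and the empty path is the empty
  list. A path is regular iff it satisfies the library predicate \<^const>\<open>distinct_adj\<close>.
  A formal linear combination \<open>u\<close> of elementary paths is its coefficient function, so \<open>u x\<close> is the
  coefficient of \<open>e\<^sub>x\<close>; the vertex sets are finite, so all the combinations used have finite support.
\<close>

type_synonym ('a, 'k) chain = "'a list \<Rightarrow> 'k"

definition chain_scale :: "'k::field \<Rightarrow> ('a, 'k) chain \<Rightarrow> ('a, 'k) chain" where
  "chain_scale c u = (\<lambda>x. c * u x)"

interpretation chain: vector_space chain_scale
  by unfold_locales (auto simp: chain_scale_def fun_eq_iff algebra_simps)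

definition basis_path :: "'a list \<Rightarrow> ('a, 'k::field) chain" where
  "basis_path x = (\<lambda>y. if y = x then 1 else 0)"

definition omit_nth :: "nat \<Rightarrow> 'a list \<Rightarrow> 'a list" where
  "omit_nth q x = take q x @ drop (Suc q) x"

text \<open>The boundary is truncated: it vanishes on paths consisting of a single vertex.\<close>

definition boundary_basis :: "'a list \<Rightarrow> ('a, 'k::field) chain" where
  "boundary_basis x =
     (if length x \<le> 1 then 0
      else \<Sum>q<length x. chain_scale ((-1) ^ q)
             (if distinct_adj (omit_nth q x) then basis_path (omit_nth q x) else 0))"

definition boundary :: "('a, 'k::field) chain \<Rightarrow> ('a, 'k) chain" where
  "boundary u = (\<Sum>x | u x \<noteq> 0. chain_scale (u x) (boundary_basis x))"

definition path_complex :: "'a set \<Rightarrow> 'a list set \<Rightarrow> bool" where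
  "path_complex V P \<longleftrightarrow>
     [] \<in> P \<and> P \<subseteq> lists V \<and> (\<forall>v\<in>V. [v] \<in> P) \<and>
     (\<forall>x\<in>P. x \<noteq> [] \<longrightarrow> butlast x \<in> P \<and> tl x \<in> P)"

definition regular_path_complex :: "'a set \<Rightarrow> 'a list set \<Rightarrow> bool" where
  "regular_path_complex V P \<longleftrightarrow> path_complex V P \<and> (\<forall>i. [i, i] \<notin> P)"

definition allowed_chains :: "'a list set \<Rightarrow> nat \<Rightarrow> ('a, 'k::field) chain set" where
  "allowed_chains P n = chain.span (basis_path ` {x \<in> P. length x = Suc n})"

text \<open>The case \<open>n = 0\<close> uses the convention that the space of allowed \<open>(-1)\<close>-paths is zero.\<close>

definition invariant_chains :: "'a list set \<Rightarrow> nat \<Rightarrow> ('a, 'k::field) chain set" where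
  "invariant_chains P n =
     {v \<in> allowed_chains P n.
        boundary v \<in> (case n of 0 \<Rightarrow> {0} | Suc m \<Rightarrow> allowed_chains P m)}"

definition step_like :: "('a \<times> 'b) list \<Rightarrow> bool" where
  "step_like z \<longleftrightarrow>
     distinct_adj z \<and> successively (\<lambda>s t. fst s = fst t \<or> snd s = snd t) z"

definition proj_X :: "('a \<times> 'b) list \<Rightarrow> 'a list" where
  "proj_X z = remdups_adj (map fst z)"

definition proj_Y :: "('a \<times> 'b) list \<Rightarrow> 'b list" where
  "proj_Y z = remdups_adj (map snd z)"

text \<open>
  A unit cell below the staircase of \<open>z\<close> corresponds to a vertical couple (row of the cell)
  followed later by a horizontal couple (column of the cell).
\<close>

definition elevation :: "('a \<times> 'b) list \<Rightarrow> nat" where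
  "elevation z =
     card {(k, l). k < l \<and> Suc l < length z \<and>
                   fst (z ! k) = fst (z ! Suc k) \<and> snd (z ! l) = snd (z ! Suc l)}"

text \<open>
  The degrees \<open>p\<close> and \<open>q\<close> of \<open>u\<close> and \<open>v\<close> need not be arguments: a \<open>p\<close>-chain vanishes on every list
  that is not a \<open>p\<close>-path.
\<close>

definition cross :: "('a, 'k::field) chain \<Rightarrow> ('b, 'k) chain \<Rightarrow> ('a \<times> 'b, 'k) chain" where
  "cross u v =
     (\<lambda>z. if step_like z then (-1) ^ elevation z * u (proj_X z) * v (proj_Y z) else 0)"

definition cartesian_product :: "'a list set \<Rightarrow> 'b list set \<Rightarrow> ('a \<times> 'b) list set" where
  "cartesian_product PX PY = {z. step_like z \<and> proj_X z \<in> PX \<and> proj_Y z \<in> PY}"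

end

theory Submission
  imports Defs
begin

text \<open>
  Call a vertex of a staircase a corner if a horizontal and a vertical couple meet there. Deleting a
  corner of an allowed path on \<open>X \<times> Y\<close> leaves a path with a diagonal couple, which is not
  allowed; exactly two step-like paths have this face, and they differ by the reflection of one unit
  cell. The vanishing of the boundary there says that \<open>w\<close> changes sign when a corner is
  reflected (\<open>corner_flip\<close>). Reflections connect all the staircases with given projections
  \<open>x\<close>, \<open>y\<close>, and each of them changes the elevation by one, so
  \<open>w z = (-1) ^ elevation z * c x y\<close> for a matrix \<open>c\<close>, namely the values of \<open>w\<close> on
  the staircases of elevation zero (\<open>step_like_coeff\<close>).

  Next, each column of \<open>c\<close> is \<open>\<partial>\<close>-invariant on \<open>X\<close>, degree by degree. If
  \<open>x'\<close> is not allowed, the staircase of elevation zero over \<open>x'\<close> and \<open>y\<close> is not allowed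
  either. To make it allowed by inserting a vertex, the insertion has to alter the projection
  \<open>x'\<close>, and every such insertion comes from the insertion of a vertex into \<open>x'\<close>. With the
  signs taken into account, the coefficient of \<open>\<partial> w\<close> at this staircase is the coefficient of
  \<open>\<partial> (c(\<cdot>, y))\<close> at \<open>x'\<close>, and it vanishes (\<open>column_boundary\<close>). Exchanging the two factors
  gives the same for the rows (\<open>row_boundary\<close>).

  Finally, a matrix with columns in \<open>U\<close> and rows in \<open>V\<close> is a finite sum of products
  \<open>u(x) v(y)\<close> with \<open>u \<in> U\<close> and \<open>v \<in> V\<close>, by Gaussian elimination
  (\<open>matrix_decomposition\<close>). The definition of the cross product turns such a sum into the required
  representation of \<open>w\<close>.
\<close>

section \<open>Matrices with prescribed row and column spaces\<close>

lemma sum_fun_apply: "(\<Sum>i\<in>A. f i) x = (\<Sum>i\<in>A. f i x)" for f :: "'i \<Rightarrow> 'c \<Rightarrow> 'k::comm_monoid_add"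
  by (induction A rule: infinite_finite_induct) auto

lemma subspace_linear_combination:
  assumes "chain.subspace U" "u \<in> U" "v \<in> U"
  shows "(\<lambda>x. u x + t * v x) \<in> U"
proof -
  have "u + chain_scale t v \<in> U"
    using assms by (intro chain.subspace_add chain.subspace_scale)
  also have "u + chain_scale t v = (\<lambda>x. u x + t * v x)"
    by (auto simp: fun_eq_iff chain_scale_def)
  finally show ?thesis .
qed

lemma subspace_scaled:
  assumes "chain.subspace U" "u \<in> U"
  shows "(\<lambda>x. t * u x) \<in> U"
  using chain.subspace_scale[OF assms, of t] by (simp add: chain_scale_def)

text \<open>
  In terms of tensors, \<open>(U \<otimes> F) \<inter> (E \<otimes> V) = U \<otimes> V\<close> for subspaces \<open>U\<close> of \<open>E\<close>
  and \<open>V\<close> of \<open>F\<close>. Subtracting from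
  \<open>c\<close> the rank one matrix \<open>c x y0 * c x0 y / c x0 y0\<close> through a nonzero entry keeps the columns in
  \<open>U\<close> and the rows in \<open>V\<close>, clears the row \<open>x0\<close> and creates no new nonzero row.
\<close>
lemma matrix_decomposition:
  fixes c :: "'a list \<Rightarrow> 'b list \<Rightarrow> 'k::field"
  assumes U: "chain.subspace U" and V: "chain.subspace V"
    and "finite {x. \<exists>y. c x y \<noteq> 0}"
    and "\<And>y. (\<lambda>x. c x y) \<in> U" and "\<And>x. c x \<in> V"
  shows "\<exists>(m::nat) u v. (\<forall>i<m. u i \<in> U \<and> v i \<in> V) \<and> (\<forall>x y. c x y = (\<Sum>i<m. u i x * v i y))"
  using assms(3-)
proof (induction "card {x. \<exists>y. c x y \<noteq> 0}" arbitrary: c rule: less_induct)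
  case less
  let ?rows = "\<lambda>c :: 'a list \<Rightarrow> 'b list \<Rightarrow> 'k. {x. \<exists>y. c x y \<noteq> 0}"
  show ?case
  proof (cases "?rows c = {}")
    case True
    then show ?thesis by (intro exI[of _ 0]) auto
  next
    case False
    then obtain x0 y0 where nz: "c x0 y0 \<noteq> 0" by blast
    define d where "d = (\<lambda>x y. c x y + (- c x y0 / c x0 y0) * c x0 y)"
    have "d x y = 0" if "\<forall>y. c x y = 0" for x y
      using that by (simp add: d_def)
    then have "?rows d \<subseteq> ?rows c"
      by blast
    moreover have "x0 \<in> ?rows c" "x0 \<notin> ?rows d"
      using nz by (auto simp: d_def)
    ultimately have less_rows: "?rows d \<subset> ?rows c" by blast
    have dV: "d x \<in> V" for x
      unfolding d_def by (rule subspace_linear_combination[OF V less.prems(3) less.prems(3)])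
    have dU: "(\<lambda>x. d x y) \<in> U" for y
    proof -
      have "(\<lambda>x. d x y) = (\<lambda>x. c x y + (- c x0 y / c x0 y0) * c x y0)"
        by (auto simp: d_def fun_eq_iff)
      then show ?thesis
        using subspace_linear_combination[OF U less.prems(2) less.prems(2)] by metis
    qed
    have "finite (?rows d)"
      using less_rows less.prems(1) by (meson finite_subset psubset_imp_subset)
    moreover have "card (?rows d) < card (?rows c)"
      using less_rows less.prems(1) by (rule psubset_card_mono[rotated])
    ultimately obtain m :: nat and u v where uv: "\<forall>i<m. u i \<in> U \<and> v i \<in> V"
      and d: "\<And>x y. d x y = (\<Sum>i<m. u i x * v i y)"
      using less.hyps[of d] dU dV by blast
    define u' where "u' = u(m := (\<lambda>x. inverse (c x0 y0) * c x y0))"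
    define v' where "v' = v(m := c x0)"
    have "u' i \<in> U \<and> v' i \<in> V" if "i < Suc m" for i
      using that uv less.prems subspace_scaled[OF U less.prems(2)]
      by (auto simp: u'_def v'_def less_Suc_eq)
    moreover have "c x y = (\<Sum>i<Suc m. u' i x * v' i y)" for x y
    proof -
      have "(\<Sum>i<m. u' i x * v' i y) = d x y"
        unfolding d by (rule sum.cong) (auto simp: u'_def v'_def)
      then show ?thesis
        by (simp add: u'_def v'_def d_def field_simps)
    qed
    ultimately show ?thesis by blast
  qed
qed

section \<open>Coefficients of the boundary\<close>

definition insert_nth :: "nat \<Rightarrow> 'a \<Rightarrow> 'a list \<Rightarrow> 'a list" where
  "insert_nth k a x = take k x @ a # drop k x"

text \<open>
  The coefficient of \<open>\<partial> u\<close> at a regular path \<open>x'\<close>, arranged by the insertions of one vertex into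
  \<open>x'\<close> instead of the faces of the paths in \<open>u\<close>. An invariant path is tested on one fixed
  path \<open>x'\<close> that is not allowed, and its insertions are then the terms to be compared.
\<close>
definition boundary_coeff :: "'a set \<Rightarrow> ('a, 'k::field) chain \<Rightarrow> 'a list \<Rightarrow> 'k" where
  "boundary_coeff V u x' = (\<Sum>k\<le>length x'. (-1) ^ k * (\<Sum>a\<in>V. u (insert_nth k a x')))"

lemma length_insert_nth [simp]: "length (insert_nth k a x) = Suc (length x)"
  by (simp add: insert_nth_def)

lemma set_insert_nth [simp]: "set (insert_nth k a x) = insert a (set x)"
  by (simp add: insert_nth_def) (metis set_append append_take_drop_id)

lemma omit_insert_nth: "k \<le> length x \<Longrightarrow> omit_nth k (insert_nth k a x) = x"
  by (simp add: insert_nth_def omit_nth_def)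

lemma insert_omit_nth: "k < length x \<Longrightarrow> insert_nth k (x ! k) (omit_nth k x) = x"
  by (simp add: insert_nth_def omit_nth_def id_take_nth_drop[symmetric])

lemma inj_insert_nth: "inj (\<lambda>a. insert_nth k a x)"
  by (auto simp: inj_def insert_nth_def)

text \<open>There are finitely many paths of a given length, so a span of basis paths is a support condition.\<close>
lemma allowed_chains_iff:
  fixes u :: "('a, 'k::field) chain"
  assumes "finite V" and "P \<subseteq> lists V"
  shows "u \<in> allowed_chains P n \<longleftrightarrow> (\<forall>x. u x \<noteq> 0 \<longrightarrow> x \<in> P \<and> length x = Suc n)"
proof
  let ?S = "{x \<in> P. length x = Suc n}"
  let ?T = "{u :: ('a, 'k) chain. \<forall>x. u x \<noteq> 0 \<longrightarrow> x \<in> ?S}"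
  have "chain.subspace ?T"
    by (rule chain.subspaceI) (auto simp: chain_scale_def, (metis add.right_neutral)+)
  moreover have "basis_path ` ?S \<subseteq> ?T"
    by (auto simp: basis_path_def split: if_splits)
  ultimately have "allowed_chains P n \<subseteq> ?T"
    unfolding allowed_chains_def by (rule chain.span_minimal[rotated])
  then show "u \<in> allowed_chains P n \<Longrightarrow> \<forall>x. u x \<noteq> 0 \<longrightarrow> x \<in> P \<and> length x = Suc n"
    by blast
next
  let ?S = "{x \<in> P. length x = Suc n}"
  assume supp: "\<forall>x. u x \<noteq> 0 \<longrightarrow> x \<in> P \<and> length x = Suc n"
  have "finite {xs. set xs \<subseteq> V \<and> length xs = Suc n}"
    using assms(1) by (rule finite_lists_length_eq)
  then have fin: "finite ?S"
    using assms(2) by (rule_tac finite_subset) auto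
  have "u = (\<Sum>x\<in>?S. chain_scale (u x) (basis_path x))"
  proof
    fix y
    have "(\<Sum>x\<in>?S. chain_scale (u x) (basis_path x)) y = (\<Sum>x\<in>?S. if y = x then u x else 0)"
      unfolding sum_fun_apply by (rule sum.cong) (auto simp: chain_scale_def basis_path_def)
    also have "\<dots> = u y"
      using fin supp by auto
    finally show "u y = (\<Sum>x\<in>?S. chain_scale (u x) (basis_path x)) y" ..
  qed
  also have "\<dots> \<in> allowed_chains P n"
    unfolding allowed_chains_def by (intro chain.span_sum chain.span_scale chain.span_base) auto
  finally show "u \<in> allowed_chains P n" .
qed

lemma boundary_apply:
  fixes u :: "('a, 'k::field) chain"
  assumes V: "finite V" and supp: "\<And>x. u x \<noteq> 0 \<Longrightarrow> x \<in> lists V \<and> length x = Suc n"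
  shows "boundary u x' =
    (if n \<noteq> 0 \<and> distinct_adj x' \<and> length x' = n then boundary_coeff V u x' else 0)"
proof -
  let ?S = "{x. set x \<subseteq> V \<and> length x = Suc n}"
  have fin: "finite ?S" using V by (rule finite_lists_length_eq)
  have "boundary u x' = (\<Sum>x | u x \<noteq> 0. u x * boundary_basis x x')"
    by (simp add: boundary_def sum_fun_apply chain_scale_def)
  also have "\<dots> = (\<Sum>x\<in>?S. u x * boundary_basis x x')"
    using fin supp by (intro sum.mono_neutral_left) auto
  finally have eq: "boundary u x' = (\<Sum>x\<in>?S. u x * boundary_basis x x')" .
  show ?thesis
  proof (cases "n \<noteq> 0 \<and> distinct_adj x' \<and> length x' = n")
    case False
    have "boundary_basis x x' = (0::'k)" if "x \<in> ?S" for x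
      using that False
      by (auto simp: boundary_basis_def sum_fun_apply chain_scale_def basis_path_def omit_nth_def
          intro!: sum.neutral)
    then show ?thesis using eq False by auto
  next
    case True
    have basis: "boundary_basis x x' = (\<Sum>q\<le>n. (-1) ^ q * (if omit_nth q x = x' then 1 else 0 :: 'k))"
      if "x \<in> ?S" for x
    proof -
      have "boundary_basis x x' = (\<Sum>q<length x. (-1) ^ q *
          (if distinct_adj (omit_nth q x) then basis_path (omit_nth q x) else 0) x' :: 'k)"
        using that True by (simp add: boundary_basis_def sum_fun_apply chain_scale_def)
      also have "\<dots> = (\<Sum>q\<le>n. (-1) ^ q * (if omit_nth q x = x' then 1 else 0))"
        using that True by (intro sum.cong) (auto simp: basis_path_def)
      finally show ?thesis .
    qed
    have "boundary u x' =
        (\<Sum>x\<in>?S. \<Sum>q\<le>n. u x * ((-1) ^ q * (if omit_nth q x = x' then 1 else 0)))"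
      unfolding eq by (rule sum.cong) (simp_all only: basis sum_distrib_left)
    also have "\<dots> = (\<Sum>q\<le>n. \<Sum>x\<in>?S. u x * ((-1) ^ q * (if omit_nth q x = x' then 1 else 0)))"
      by (rule sum.swap)
    \<comment> \<open>The paths whose \<open>q\<close>-th face is \<open>x'\<close> are the insertions of one vertex at position \<open>q\<close>.\<close>
    also have "\<dots> = (\<Sum>q\<le>n. (-1) ^ q * (\<Sum>a\<in>V. u (insert_nth q a x')))"
    proof (rule sum.cong)
      fix q assume q: "q \<in> {..n}"
      let ?F = "{x \<in> ?S. omit_nth q x = x'}"
      have "(\<Sum>x\<in>?S. u x * ((-1) ^ q * (if omit_nth q x = x' then 1 else 0))) =
          (-1) ^ q * (\<Sum>x\<in>?S. if omit_nth q x = x' then u x else 0)"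
        unfolding sum_distrib_left by (rule sum.cong) auto
      also have "(\<Sum>x\<in>?S. if omit_nth q x = x' then u x else 0) = (\<Sum>x\<in>?F. u x)"
        using fin by (rule sum.inter_filter[symmetric])
      also have "\<dots> = (\<Sum>x\<in>(\<lambda>a. insert_nth q a x') ` V. u x)"
      proof (rule sum.mono_neutral_left)
        show "?F \<subseteq> (\<lambda>a. insert_nth q a x') ` V"
        proof
          fix x assume x: "x \<in> ?F"
          then have "x = insert_nth q (x ! q) x'"
            using insert_omit_nth[of q x] q by auto
          moreover have "x ! q \<in> V" using x q by (force simp: less_Suc_eq_le)
          ultimately show "x \<in> (\<lambda>a. insert_nth q a x') ` V" by blast
        qed
        show "\<forall>x\<in>(\<lambda>a. insert_nth q a x') ` V - ?F. u x = 0"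
        proof (rule ballI, rule ccontr)
          fix x assume "x \<in> (\<lambda>a. insert_nth q a x') ` V - ?F" "u x \<noteq> 0"
          then show False
            using supp[of x] omit_insert_nth[of q x'] q True by auto
        qed
      qed (use V in auto)
      also have "\<dots> = (\<Sum>a\<in>V. u (insert_nth q a x'))"
        by (subst sum.reindex) (auto intro: inj_on_subset[OF inj_insert_nth])
      finally show "(\<Sum>x\<in>?S. u x * ((-1) ^ q * (if omit_nth q x = x' then 1 else 0))) =
          (-1) ^ q * (\<Sum>a\<in>V. u (insert_nth q a x'))" .
    qed simp
    finally show ?thesis using True by (simp add: boundary_coeff_def)
  qed
qed

text \<open>
  In degree zero the second condition concerns only the empty path and is void because the empty path
  is in \<open>P\<close>; this matches the truncated boundary, which is zero there.
\<close>
lemma invariant_chains_iff: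
  fixes u :: "('a, 'k::field) chain"
  assumes V: "finite V" and P: "P \<subseteq> lists V" and nil: "[] \<in> P"
  shows "u \<in> invariant_chains P n \<longleftrightarrow>
    (\<forall>x. u x \<noteq> 0 \<longrightarrow> x \<in> P \<and> length x = Suc n) \<and>
    (\<forall>x'. distinct_adj x' \<longrightarrow> length x' = n \<longrightarrow> x' \<notin> P \<longrightarrow> boundary_coeff V u x' = 0)"
proof (cases "\<forall>x. u x \<noteq> 0 \<longrightarrow> x \<in> P \<and> length x = Suc n")
  case True
  then have supp: "x \<in> lists V \<and> length x = Suc n" if "u x \<noteq> 0" for x
    using that P by blast
  have *: "u \<in> allowed_chains P n"
    using True by (simp only: allowed_chains_iff[OF V P])
  note bd = boundary_apply[OF V supp]
  show ?thesis
  proof (cases n)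
    case 0
    have "boundary u = 0" using bd 0 by (auto simp: fun_eq_iff)
    then show ?thesis using * True 0 nil by (auto simp: invariant_chains_def)
  next
    case (Suc m)
    have "u \<in> invariant_chains P n \<longleftrightarrow> boundary u \<in> allowed_chains P m"
      using * Suc by (simp add: invariant_chains_def)
    also have "\<dots> \<longleftrightarrow> (\<forall>x'. boundary u x' \<noteq> 0 \<longrightarrow> x' \<in> P \<and> length x' = n)"
      by (simp add: allowed_chains_iff[OF V P] Suc)
    also have "\<dots> \<longleftrightarrow> (\<forall>x'. distinct_adj x' \<longrightarrow> length x' = n \<longrightarrow> x' \<notin> P \<longrightarrow> boundary_coeff V u x' = 0)"
      using Suc by (auto simp: bd)
    finally show ?thesis using True by blast
  qed
next
  case False
  then show ?thesis
    using allowed_chains_iff[OF V P, of u n] by (auto simp: invariant_chains_def)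
qed

lemma subspace_invariant_chains:
  assumes V: "finite V" and P: "P \<subseteq> lists V" and nil: "[] \<in> P"
  shows "chain.subspace (invariant_chains P n :: ('a, 'k::field) chain set)"
proof (rule chain.subspaceI)
  note iff = invariant_chains_iff[OF V P nil]
  show "0 \<in> invariant_chains P n"
    by (simp add: iff boundary_coeff_def)
  fix u v :: "('a, 'k) chain" and t
  assume u: "u \<in> invariant_chains P n"
  have "boundary_coeff V (chain_scale t u) x = t * boundary_coeff V u x" for x
    by (simp add: boundary_coeff_def chain_scale_def sum_distrib_left mult.left_commute)
  then show "chain_scale t u \<in> invariant_chains P n"
    using u by (simp add: iff chain_scale_def)
  assume v: "v \<in> invariant_chains P n"
  have "boundary_coeff V (u + v) x = boundary_coeff V u x + boundary_coeff V v x" for x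
    by (simp add: boundary_coeff_def sum.distrib algebra_simps)
  then show "u + v \<in> invariant_chains P n"
    using u v unfolding iff by (auto, (metis add.right_neutral)+)
qed

section \<open>Staircases and their elevation\<close>

lemma remdups_adj_insert_duplicate: "remdups_adj (xs @ a # a # ys) = remdups_adj (xs @ a # ys)"
  using remdups_adj_append[of xs a "a # ys"] remdups_adj_append[of xs a ys] by simp

text \<open>
  The staircase of elevation zero with projections \<open>x\<close> and \<open>y\<close>. It serves as the
  representative of all staircases with these projections.
\<close>
definition row_then_column :: "'a list \<Rightarrow> 'b list \<Rightarrow> ('a \<times> 'b) list" where
  "row_then_column x y = map (\<lambda>a. (a, hd y)) x @ map (Pair (last x)) (tl y)"

lemma length_row_then_column [simp]:
  "length (row_then_column x y) = length x + (length y - 1)"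
  by (simp add: row_then_column_def)

lemma remdups_adj_snoc_same: "remdups_adj (xs @ [a] @ map (\<lambda>_. a) ys) = remdups_adj (xs @ [a])"
  by (induction ys) (use remdups_adj_insert_duplicate[of xs a] in auto)

lemma remdups_adj_same_Cons: "remdups_adj (map (\<lambda>_. b) xs @ b # ys) = remdups_adj (b # ys)"
proof (induction xs)
  case (Cons x xs)
  then show ?case by (cases xs) auto
qed simp

lemma proj_X_row_then_column:
  assumes "x \<noteq> []" "distinct_adj x"
  shows "proj_X (row_then_column x y) = x"
proof -
  have "map fst (row_then_column x y) = butlast x @ [last x] @ map (\<lambda>_. last x) (tl y)"
    using assms by (simp add: row_then_column_def comp_def)
  then show ?thesis
    using assms remdups_adj_snoc_same[of "butlast x" "last x" "tl y"]
    by (simp add: proj_X_def distinct_adj_altdef)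
qed

lemma proj_Y_row_then_column:
  assumes "x \<noteq> []" "y \<noteq> []" "distinct_adj y"
  shows "proj_Y (row_then_column x y) = y"
proof -
  have "map snd (row_then_column x y) = map (\<lambda>_. hd y) (tl x) @ hd y # tl y"
    using assms
    by (cases x) (simp_all add: row_then_column_def comp_def map_replicate_const
        replicate_app_Cons_same[symmetric])
  then show ?thesis
    using assms remdups_adj_same_Cons[of "hd y" "tl x" "tl y"]
    by (simp add: proj_Y_def distinct_adj_altdef)
qed

lemma distinct_adj_row_then_column:
  assumes "x \<noteq> []" "y \<noteq> []"
  shows "distinct_adj (row_then_column x y) \<longleftrightarrow> distinct_adj x \<and> distinct_adj y"
proof -
  have "distinct_adj (row_then_column x y) \<longleftrightarrow> distinct_adj x \<and> distinct_adj (tl y) \<and>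
     (tl y \<noteq> [] \<longrightarrow> hd y \<noteq> hd (tl y))"
    using assms
    by (auto simp: row_then_column_def distinct_adj_append_iff distinct_adj_map_iff inj_on_def
        last_map hd_map)
  also have "\<dots> \<longleftrightarrow> distinct_adj x \<and> distinct_adj y"
    using assms by (cases y; cases "tl y") auto
  finally show ?thesis .
qed

lemma step_like_append_iff:
  "step_like (s @ t) \<longleftrightarrow> step_like s \<and> step_like t \<and>
     (s \<noteq> [] \<longrightarrow> t \<noteq> [] \<longrightarrow> last s \<noteq> hd t \<and> (fst (last s) = fst (hd t) \<or> snd (last s) = snd (hd t)))"
  by (auto simp: step_like_def distinct_adj_append_iff successively_append_iff)

lemma step_like_Cons_Cons:
  "step_like (s # t # z) \<longleftrightarrow> s \<noteq> t \<and> (fst s = fst t \<or> snd s = snd t) \<and> step_like (t # z)"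
  by (auto simp: step_like_def)

lemma step_like_simple [simp]: "step_like []" "step_like [s]"
  by (auto simp: step_like_def)

lemma card_horizontal:
  assumes "step_like z" "z \<noteq> []"
  shows "card {l. Suc l < length z \<and> snd (z ! l) = snd (z ! Suc l)} = length (proj_X z) - 1"
  using assms
proof (induction z rule: induct_list012)
  case (3 s t z)
  let ?H = "\<lambda>z. {l. Suc l < length z \<and> snd (z ! l) = snd (z ! Suc l)}"
  have *: "?H (s # t # z) = (if snd s = snd t then {0} else {}) \<union> Suc ` ?H (t # z)"
    by (auto simp: image_iff nth_Cons gr0_conv_Suc split: nat.splits) (metis not0_implies_Suc)+
  have fin: "finite (?H (t # z))" by (rule finite_subset[of _ "{..length (t#z)}"]) auto
  have "card (?H (s # t # z)) = (if snd s = snd t then 1 else 0) + card (?H (t # z))"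
    unfolding * using fin by (auto simp: card_insert_if card_image)
  also have "card (?H (t # z)) = length (proj_X (t # z)) - 1"
    using 3 by (simp add: step_like_Cons_Cons)
  finally show ?case
    using "3.prems" by (auto simp: step_like_Cons_Cons proj_X_def prod_eq_iff Suc_diff_le)
qed (auto simp: proj_X_def)

text \<open>
  A vertical first couple forms one cell with each later horizontal couple, and the number of those is
  the degree of the projection onto \<open>X\<close>.
\<close>
lemma elevation_Cons_Cons:
  assumes "step_like (t # z)"
  shows "elevation (s # t # z) =
    (if fst s = fst t then length (proj_X (t # z)) - 1 else 0) + elevation (t # z)"
proof -
  let ?C = "\<lambda>z::('a \<times> 'b) list. {(k, l). k < l \<and> Suc l < length z \<and>
              fst (z ! k) = fst (z ! Suc k) \<and> snd (z ! l) = snd (z ! Suc l)}"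
  let ?H = "{l. Suc l < length (t # z) \<and> snd ((t # z) ! l) = snd ((t # z) ! Suc l)}"
  let ?A = "(\<lambda>l. (0::nat, Suc l)) ` (if fst s = fst t then ?H else {})"
  let ?B = "map_prod Suc Suc ` ?C (t # z)"
  have fin: "finite ?H" by (rule finite_subset[of _ "{..length (t#z)}"]) auto
  have finC: "finite (?C (t # z))"
    by (rule finite_subset[of _ "{..length (t # z)} \<times> {..length (t # z)}"]) auto
  have "?C (s # t # z) = ?A \<union> ?B"
  proof (intro set_eqI)
    fix kl :: "nat \<times> nat"
    obtain k l where kl: "kl = (k, l)" by force
    show "kl \<in> ?C (s # t # z) \<longleftrightarrow> kl \<in> ?A \<union> ?B"
      by (cases k; cases l) (auto simp: kl image_iff)
  qed
  moreover have "card (?A \<union> ?B) = card ?A + card ?B"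
    using fin finC by (intro card_Un_disjoint) auto
  moreover have "card ?B = card (?C (t # z))"
    by (intro card_image) (auto simp: inj_on_def)
  moreover have "card ?A = (if fst s = fst t then card ?H else 0)"
    by (auto simp: card_image inj_on_def)
  ultimately show ?thesis
    using card_horizontal[OF assms] by (simp add: elevation_def)
qed

lemma elevation_singleton [simp]: "elevation [s] = 0"
  by (simp add: elevation_def)

lemma proj_X_Cons_Cons:
  "proj_X (s # t # z) = (if fst s = fst t then proj_X (t # z) else fst s # proj_X (t # z))"
  by (simp add: proj_X_def)

lemma proj_Y_Cons_Cons:
  "proj_Y (s # t # z) = (if snd s = snd t then proj_Y (t # z) else snd s # proj_Y (t # z))"
  by (simp add: proj_Y_def)

lemma hd_proj: "z \<noteq> [] \<Longrightarrow> hd (proj_X z) = fst (hd z)" "z \<noteq> [] \<Longrightarrow> hd (proj_Y z) = snd (hd z)"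
  by (simp_all add: proj_X_def proj_Y_def hd_map)

lemma proj_eq_Nil [simp]: "proj_X z = [] \<longleftrightarrow> z = []" "proj_Y z = [] \<longleftrightarrow> z = []"
  by (simp_all add: proj_X_def proj_Y_def)

lemma distinct_adj_proj [simp]: "distinct_adj (proj_X z)" "distinct_adj (proj_Y z)"
  by (simp_all add: proj_X_def proj_Y_def)

section \<open>Invariant chains on a product\<close>

definition path_coeff :: "('a \<times> 'b, 'k::field) chain \<Rightarrow> 'a list \<Rightarrow> 'b list \<Rightarrow> 'k" where
  "path_coeff w x y = (if x = [] \<or> y = [] then 0 else w (row_then_column x y))"

text \<open>
  A \<open>\<partial>\<close>-invariant \<open>r\<close>-path \<open>w\<close> on the product, with the invariance spelled out in
  coefficients. The assumptions are symmetric in the two factors, which allows the locale to be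
  interpreted a second time with the factors exchanged.
\<close>
locale invariant_product_chain =
  fixes X :: "'a set" and Y :: "'b set" and PX :: "'a list set" and PY :: "'b list set"
    and r :: nat and w :: "('a \<times> 'b, 'k::field) chain"
  assumes finite_X: "finite X" and finite_Y: "finite Y"
    and PX: "PX \<subseteq> lists X" and PY: "PY \<subseteq> lists Y"
    and Nil_PX: "[] \<in> PX" and Nil_PY: "[] \<in> PY"
    and support: "w z \<noteq> 0 \<Longrightarrow> z \<in> cartesian_product PX PY \<and> length z = Suc r"
    and boundary_zero: "distinct_adj d \<Longrightarrow> length d = r \<Longrightarrow> d \<notin> cartesian_product PX PY \<Longrightarrow>
      boundary_coeff (X \<times> Y) w d = 0"
begin

lemma
  assumes "w z \<noteq> 0"
  shows support_step_like: "step_like z" and support_distinct_adj: "distinct_adj z"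
    and support_proj_X: "proj_X z \<in> PX" and support_proj_Y: "proj_Y z \<in> PY"
    and support_length: "length z = Suc r" and support_set: "set z \<subseteq> X \<times> Y"
proof -
  have z: "step_like z" "proj_X z \<in> PX" "proj_Y z \<in> PY" "length z = Suc r"
    using support[OF assms] by (auto simp: cartesian_product_def)
  then show "step_like z" "proj_X z \<in> PX" "proj_Y z \<in> PY" "length z = Suc r" "distinct_adj z"
    by (simp_all add: step_like_def)
  have "fst ` set z \<subseteq> X" "snd ` set z \<subseteq> Y"
    using z PX PY by (fastforce simp: proj_X_def proj_Y_def in_lists_conv_set)+
  then show "set z \<subseteq> X \<times> Y" by force
qed

lemma boundary_coeff_eq_0:
  assumes "distinct_adj d" "d \<notin> cartesian_product PX PY"
  shows "boundary_coeff (X \<times> Y) w d = 0"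
proof (cases "length d = r")
  case False
  have "w (insert_nth k e d) = 0" for k e
    using support_length[of "insert_nth k e d"] False by auto
  then show ?thesis by (simp add: boundary_coeff_def)
qed (use assms boundary_zero in blast)

text \<open>
  The path \<open>d\<close> obtained by removing the corner has the diagonal couple from \<open>(a, b)\<close> to
  \<open>(a', b')\<close>. Every insertion elsewhere keeps this couple, and between its two ends only
  \<open>(a', b)\<close> and \<open>(a, b')\<close> give step-like paths. Both occur with the same sign in the coefficient of
  \<open>\<partial> w\<close> at \<open>d\<close>, which is zero. If the two parts next to the corner are not themselves step-like,
  both values are zero.
\<close>
lemma corner_flip:
  assumes "a \<noteq> a'" "b \<noteq> b'"
  shows "w (s @ (a, b) # (a', b) # (a', b') # t) = - w (s @ (a, b) # (a, b') # (a', b') # t)"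
proof (cases "step_like (s @ [(a, b)]) \<and> step_like ((a', b') # t)")
  case False
  have "\<not> step_like (s @ (a, b) # e # (a', b') # t)" for e
    using False step_like_append_iff[of "s @ [(a, b)]" "e # (a', b') # t"]
      step_like_append_iff[of "[e]" "(a', b') # t"] by auto
  then show ?thesis using support_step_like by (metis neg_0_equal_iff_equal)
next
  case True
  define d where "d = s @ (a, b) # (a', b') # t"
  have diagonal: "\<not> step_like (s' @ (a, b) # (a', b') # t')" for s' t'
    using assms step_like_append_iff[of s' "(a, b) # (a', b') # t'"] by (auto simp: step_like_Cons_Cons)
  have "distinct_adj (s @ [(a, b)])" "distinct_adj ((a', b') # t)"
    using True by (simp_all add: step_like_def)
  then have "distinct_adj ((s @ [(a, b)]) @ (a', b') # t)"
    unfolding distinct_adj_append_iff using assms by simp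
  then have "boundary_coeff (X \<times> Y) w d = 0"
    using diagonal by (intro boundary_coeff_eq_0) (simp_all add: d_def cartesian_product_def)
  moreover have "w (insert_nth k e d) = 0" if "k \<noteq> Suc (length s)" for k e
  proof (cases "k \<le> length s")
    case True
    then have "insert_nth k e d = (take k s @ e # drop k s) @ (a, b) # (a', b') # t"
      by (simp add: insert_nth_def d_def)
    then show ?thesis using diagonal support_step_like by metis
  next
    case False
    with that obtain j where "k = Suc (Suc (length s)) + j"
      using less_iff_Suc_add[of "Suc (length s)" k] by auto
    then have "insert_nth k e d = s @ (a, b) # (a', b') # take j t @ e # drop j t"
      by (simp add: insert_nth_def d_def)
    then show ?thesis using diagonal support_step_like by metis
  qed
  then have delta: "boundary_coeff (X \<times> Y) w d =
      (\<Sum>k\<le>length d. if k = Suc (length s) then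
         (-1) ^ Suc (length s) * (\<Sum>e\<in>X \<times> Y. w (s @ (a, b) # e # (a', b') # t)) else 0)"
    unfolding boundary_coeff_def by (intro sum.cong) (auto simp: insert_nth_def d_def)
  have le: "Suc (length s) \<le> length d" by (simp add: d_def)
  have "boundary_coeff (X \<times> Y) w d =
      (-1) ^ Suc (length s) * (\<Sum>e\<in>X \<times> Y. w (s @ (a, b) # e # (a', b') # t))"
    unfolding delta by (subst sum.delta) (use le in simp_all)
  moreover have "(\<Sum>e\<in>X \<times> Y. w (s @ (a, b) # e # (a', b') # t)) =
      (\<Sum>e\<in>{(a', b), (a, b')}. w (s @ (a, b) # e # (a', b') # t))"
  proof (rule sum.mono_neutral_cong)
    show "w (s @ (a, b) # e # (a', b') # t) = 0" if e: "e \<in> X \<times> Y - {(a', b), (a, b')}" for e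
    proof (rule ccontr)
      assume "w (s @ (a, b) # e # (a', b') # t) \<noteq> 0"
      then have "step_like ((a, b) # e # (a', b') # t)"
        using support_step_like step_like_append_iff by metis
      then show False using e assms by (cases e) (auto simp: step_like_Cons_Cons)
    qed
    show "w (s @ (a, b) # e # (a', b') # t) = 0" if e: "e \<in> {(a', b), (a, b')} - X \<times> Y" for e
    proof (rule ccontr)
      assume "w (s @ (a, b) # e # (a', b') # t) \<noteq> 0"
      then show False using support_set[of "s @ (a, b) # e # (a', b') # t"] e by simp
    qed
  qed (use finite_X finite_Y in auto)
  ultimately show ?thesis using assms by (simp add: eq_neg_iff_add_eq_0)
qed

text \<open>Each horizontal couple passed costs one reflection of a corner, hence one sign.\<close>
lemma move_vertical_past_row:
  assumes "distinct_adj (a # xs)" "b \<noteq> b'"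
  shows "w (s @ (a, b) # map (\<lambda>x. (x, b')) (a # xs) @ t) =
    (-1) ^ length xs * w (s @ map (\<lambda>x. (x, b)) (a # xs) @ (last (a # xs), b') # t)"
  using assms
proof (induction xs arbitrary: a s)
  case (Cons x xs)
  have "w (s @ (a, b) # map (\<lambda>x. (x, b')) (a # x # xs) @ t) =
      - w ((s @ [(a, b)]) @ (x, b) # map (\<lambda>x. (x, b')) (x # xs) @ t)"
    using corner_flip[of a x b b' s "map (\<lambda>x. (x, b')) xs @ t"] Cons.prems by simp
  also have "\<dots> = - ((-1) ^ length xs *
      w ((s @ [(a, b)]) @ map (\<lambda>x. (x, b)) (x # xs) @ (last (x # xs), b') # t))"
    using Cons.IH[of x "s @ [(a, b)]"] Cons.prems by simp
  finally show ?case by simp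
qed simp

lemma move_horizontal_past_column:
  assumes "distinct_adj (b # ys)" "a \<noteq> a'"
  shows "w (s @ map (Pair a) (b # ys) @ [(a', last (b # ys))]) =
    (-1) ^ length ys * w (s @ (a, b) # map (Pair a') (b # ys))"
  using assms
proof (induction ys arbitrary: b s)
  case (Cons y ys)
  have "w (s @ map (Pair a) (b # y # ys) @ [(a', last (b # y # ys))]) =
     (-1) ^ length ys * w (s @ (a, b) # (a, y) # map (Pair a') (y # ys))"
    using Cons.IH[of y "s @ [(a, b)]"] Cons.prems by simp
  also have "w (s @ (a, b) # (a, y) # map (Pair a') (y # ys)) =
      - w (s @ (a, b) # map (Pair a') (b # y # ys))"
    using corner_flip[of a a' b y s "map (Pair a') ys"] Cons.prems by simp
  finally show ?case by simp
qed simp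

text \<open>
  The prefix \<open>s\<close> makes the induction on \<open>z\<close> work: the tail of \<open>z\<close> is straightened first,
  behind its head, and a vertical first couple is then moved past the whole row that has formed. This
  costs as many signs as the couple adds cells to the elevation.
\<close>
lemma straighten_staircase:
  assumes "step_like z" "z \<noteq> []"
  shows "w (s @ z) = (-1) ^ elevation z * w (s @ row_then_column (proj_X z) (proj_Y z))"
  using assms
proof (induction z arbitrary: s rule: induct_list012)
  case (2 e)
  then show ?case by (simp add: proj_X_def proj_Y_def row_then_column_def)
next
  case (3 e f z)
  obtain a b where e: "e = (a, b)" by force
  define x y where "x = proj_X (f # z)" and "y = proj_Y (f # z)"
  have x: "x \<noteq> []" "hd x = fst f" "distinct_adj x" and y: "y \<noteq> []" "hd y = snd f"
    by (simp_all add: x_def y_def hd_proj)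
  have fz: "step_like (f # z)" and ef: "e \<noteq> f" "a = fst f \<or> b = snd f"
    using "3.prems" by (auto simp: step_like_Cons_Cons e)
  have IH: "w (s @ e # f # z) = (-1) ^ elevation (f # z) * w (s @ e # row_then_column x y)"
    using "3.IH"(2)[of "s @ [e]"] fz by (simp add: x_def y_def)
  show ?case
  proof (cases "a = fst f")
    case False
    then have "proj_X (e # f # z) = a # x" "proj_Y (e # f # z) = y"
      using ef by (simp_all add: proj_X_Cons_Cons proj_Y_Cons_Cons e x_def y_def)
    moreover have "row_then_column (a # x) y = e # row_then_column x y"
      using False ef x y by (simp add: row_then_column_def e)
    moreover have "elevation (e # f # z) = elevation (f # z)"
      using False by (simp add: elevation_Cons_Cons[OF fz] e)
    ultimately show ?thesis using IH by simp
  next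
    case True
    then have b: "b \<noteq> hd y" using ef y e by (auto simp: prod_eq_iff)
    then have "proj_X (e # f # z) = x" "proj_Y (e # f # z) = b # y"
      using True y by (simp_all add: proj_X_Cons_Cons proj_Y_Cons_Cons e x_def y_def)
    moreover have "elevation (e # f # z) = length (tl x) + elevation (f # z)"
      using True by (simp add: elevation_Cons_Cons[OF fz] e x_def)
    moreover have "w (s @ e # row_then_column x y) =
        (-1) ^ length (tl x) * w (s @ row_then_column x (b # y))"
    proof -
      have "x = a # tl x" "y = hd y # tl y" using x y True by (cases x; cases y; simp)+
      then show ?thesis
        using move_vertical_past_row[of a "tl x" b "hd y" s "map (Pair (last x)) (tl y)"] b x
        unfolding row_then_column_def e by (metis append_Cons append_assoc list.sel(1,3) list.simps(9))
    qed
    ultimately show ?thesis using IH by (simp add: power_add)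
  qed
qed simp

lemma step_like_coeff:
  assumes "step_like z"
  shows "w z = (-1) ^ elevation z * path_coeff w (proj_X z) (proj_Y z)"
proof (cases "z = []")
  case True
  then show ?thesis using support_length[of "[]"] by (auto simp: path_coeff_def)
next
  case False
  then show ?thesis using straighten_staircase[OF assms, of "[]"] by (simp add: path_coeff_def)
qed

lemma
  assumes "path_coeff w x y \<noteq> 0"
  shows path_coeff_X: "x \<in> PX" and path_coeff_Y: "y \<in> PY"
    and path_coeff_nonempty: "x \<noteq> []" "y \<noteq> []"
    and path_coeff_distinct_adj: "distinct_adj x" "distinct_adj y"
    and path_coeff_length: "length x + length y = Suc (Suc r)"
proof -
  let ?z = "row_then_column x y"
  show ne: "x \<noteq> []" "y \<noteq> []" using assms by (auto simp: path_coeff_def)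
  then have z: "w ?z \<noteq> 0" using assms by (simp add: path_coeff_def)
  show dist: "distinct_adj x" "distinct_adj y"
    using support_distinct_adj[OF z] ne by (simp_all add: distinct_adj_row_then_column)
  show "x \<in> PX" "y \<in> PY"
    using support_proj_X[OF z] support_proj_Y[OF z] ne dist
    by (simp_all add: proj_X_row_then_column proj_Y_row_then_column)
  show "length x + length y = Suc (Suc r)"
    using support_length[OF z] ne by (cases y) auto
qed

text \<open>
  An inserted vertex over the same vertex of \<open>X\<close> as one of its neighbours would not alter the
  projection onto \<open>X\<close>, which is not allowed. So the inserted vertex forms
  horizontal couples with its neighbours.
\<close>
lemma inserted_vertex_level:
  assumes "w (s @ e # t) \<noteq> 0" "proj_X (s @ t) \<notin> PX"
  shows "s \<noteq> [] \<Longrightarrow> snd (last s) = snd e" "t \<noteq> [] \<Longrightarrow> snd (hd t) = snd e"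
proof -
  have step: "step_like (s @ e # t)" and ne: "proj_X (s @ e # t) \<noteq> proj_X (s @ t)"
    using assms support_step_like support_proj_X by metis+
  show "snd (last s) = snd e" if ne_s: "s \<noteq> []"
  proof -
    obtain s' f where s: "s = s' @ [f]" using ne_s by (cases s rule: rev_cases) auto
    have "fst f \<noteq> fst e"
      using ne remdups_adj_insert_duplicate[of "map fst s'" "fst f" "map fst t"]
      by (auto simp: proj_X_def s)
    then show ?thesis using step step_like_append_iff[of s "e # t"] by (simp add: s)
  qed
  show "snd (hd t) = snd e" if ne_t: "t \<noteq> []"
  proof -
    obtain f t' where t: "t = f # t'" using ne_t by (cases t) auto
    have "fst f \<noteq> fst e"
      using ne remdups_adj_insert_duplicate[of "map fst s" "fst f" "map fst t'"]
      by (auto simp: proj_X_def t)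
    then show ?thesis using step step_like_append_iff[of s "e # t"] by (auto simp: t step_like_Cons_Cons)
  qed
qed

lemma sum_over_level:
  assumes "\<And>e. w (insert_nth k e d) \<noteq> 0 \<Longrightarrow> snd e = b"
  shows "(\<Sum>e\<in>X \<times> Y. w (insert_nth k e d)) = (\<Sum>a\<in>X. w (insert_nth k (a, b) d))"
proof -
  have "(\<Sum>b'\<in>Y. w (insert_nth k (a, b') d)) = w (insert_nth k (a, b) d)" for a
  proof -
    have "\<forall>b'\<in>Y - {b}. w (insert_nth k (a, b') d) = 0"
      using assms by force
    moreover have "\<forall>b'\<in>{b} - Y. w (insert_nth k (a, b') d) = 0"
      using support_set[of "insert_nth k (a, b) d"] by auto
    ultimately have "(\<Sum>b'\<in>Y. w (insert_nth k (a, b') d)) = (\<Sum>b'\<in>{b}. w (insert_nth k (a, b') d))"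
      using finite_Y by (intro sum.mono_neutral_cong) auto
    then show ?thesis by simp
  qed
  then show ?thesis
    using sum.cartesian_product[of "\<lambda>a b'. w (insert_nth k (a, b') d)" Y X] by simp
qed

text \<open>
  The coefficient of \<open>\<partial> w\<close> at \<open>row_then_column x' y\<close> is zero and is computed term by term. Let
  \<open>p\<close> be the number of vertices of \<open>x'\<close> and \<open>q\<close> the number of couples of \<open>y\<close>. A
  vertex inserted inside the row lies on the level of the row and amounts to an insertion into
  \<open>x'\<close>. No vertex can be inserted inside the column, because its two neighbours lie on different
  levels. A vertex appended at the end of the column amounts to appending it to \<open>x'\<close>, up to the
  sign of the \<open>q\<close> corner reflections; as its position is \<open>p + q\<close> instead of \<open>p\<close>, the two
  factors \<open>(-1) ^ q\<close> cancel.
\<close>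
lemma column_boundary:
  assumes x': "distinct_adj x'" "x' \<notin> PX"
  shows "boundary_coeff X (\<lambda>x. path_coeff w x y) x' = 0"
proof (cases "y \<noteq> [] \<and> distinct_adj y")
  case False
  then have "path_coeff w x y = 0" for x
    using path_coeff_nonempty path_coeff_distinct_adj by blast
  then show ?thesis by (simp add: boundary_coeff_def)
next
  case True
  then have y: "y \<noteq> []" "distinct_adj y" by auto
  have x'_ne: "x' \<noteq> []" using x' Nil_PX by auto
  define d where "d = row_then_column x' y"
  define p q where "p = length x'" and "q = length (tl y)"
  define T where "T k = (\<Sum>e\<in>X \<times> Y. w (insert_nth k e d))" for k
  have len: "length d = p + q" by (simp add: d_def p_def q_def)
  have proj: "proj_X d = x'" using x' x'_ne by (simp add: d_def proj_X_row_then_column)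
  have level_before: "snd (d ! (k - 1)) = snd e"
    if nz: "w (insert_nth k e d) \<noteq> 0" and k: "0 < k" "k \<le> p + q" for k e
  proof -
    have "take k d \<noteq> []" using k len by auto
    then have "snd (last (take k d)) = snd e"
      using inserted_vertex_level(1)[of "take k d" e "drop k d"] nz k x'(2) x'_ne len
      by (simp add: insert_nth_def proj)
    moreover have "last (take k d) = d ! (k - 1)"
      using k len by (subst last_conv_nth) auto
    ultimately show ?thesis by simp
  qed
  have level_after: "snd (d ! k) = snd e"
    if nz: "w (insert_nth k e d) \<noteq> 0" and k: "k < p + q" for k e
    using inserted_vertex_level(2)[of "take k d" e "drop k d"] nz k x'(2) len
    by (simp add: insert_nth_def proj hd_drop_conv_nth)
  have nth_y: "snd (d ! (p + j - 1)) = y ! j" if "j \<le> q" for j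
    using that x'_ne y
    by (cases j) (auto simp: d_def row_then_column_def nth_append p_def q_def nth_tl hd_conv_nth)
  have nth_row: "snd (d ! k) = hd y" if "k < p" for k
    using that by (simp add: d_def row_then_column_def nth_append p_def)
  have row: "T k = (\<Sum>a\<in>X. path_coeff w (insert_nth k a x') y)" if k: "k < p" for k
  proof -
    have "T k = (\<Sum>a\<in>X. w (insert_nth k (a, hd y) d))"
      unfolding T_def
      by (rule sum_over_level) (use level_after[of k] nth_row[OF k] k in simp)
    also have "\<dots> = (\<Sum>a\<in>X. path_coeff w (insert_nth k a x') y)"
    proof (rule sum.cong)
      fix a
      have "insert_nth k (a, hd y) d = row_then_column (insert_nth k a x') y"
        using k by (simp add: insert_nth_def d_def row_then_column_def p_def take_map drop_map)
      then show "w (insert_nth k (a, hd y) d) = path_coeff w (insert_nth k a x') y"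
        using y by (simp add: path_coeff_def insert_nth_def)
    qed simp
    finally show ?thesis .
  qed
  have column: "T (p + j) = 0" if j: "j < q" for j
  proof -
    have "w (insert_nth (p + j) e d) = 0" for e
    proof (rule ccontr)
      assume *: "w (insert_nth (p + j) e d) \<noteq> 0"
      have "y ! j = y ! Suc j"
        using level_before[OF *] level_after[OF *] nth_y[of j] nth_y[of "Suc j"] j x'_ne by (simp add: p_def)
      then show False using distinct_adj_nth[OF y(2), of j] j by (auto simp: q_def less_diff_conv)
    qed
    then show ?thesis by (simp add: T_def)
  qed
  have end_of_column: "T (p + q) = (-1) ^ q * (\<Sum>a\<in>X. path_coeff w (insert_nth p a x') y)"
  proof -
    have "T (p + q) = (\<Sum>a\<in>X. w (insert_nth (p + q) (a, last y) d))"
      unfolding T_def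
      by (rule sum_over_level)
        (use level_before[of "p + q"] nth_y[of q] x'_ne y in \<open>simp add: p_def q_def last_conv_nth\<close>)
    also have "\<dots> = (\<Sum>a\<in>X. (-1) ^ q * path_coeff w (insert_nth p a x') y)"
    proof (rule sum.cong)
      fix a
      let ?s = "map (\<lambda>a. (a, hd y)) (butlast x')"
      have x'_eq: "x' = butlast x' @ [last x']" using x'_ne by simp
      have ins: "insert_nth (p + q) (a, last y) d =
          ?s @ map (Pair (last x')) (hd y # tl y) @ [(a, last (hd y # tl y))]"
      proof -
        have "d = ?s @ map (Pair (last x')) (hd y # tl y)"
          unfolding d_def row_then_column_def by (subst x'_eq) simp
        then show ?thesis using y len by (simp add: insert_nth_def)
      qed
      have coeff: "path_coeff w (insert_nth p a x') y =
          w (?s @ (last x', hd y) # map (Pair a) (hd y # tl y))"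
      proof -
        have "row_then_column (x' @ [a]) y = ?s @ (last x', hd y) # map (Pair a) (hd y # tl y)"
          unfolding row_then_column_def by (subst x'_eq) (simp del: list.collapse)
        then show ?thesis using y by (simp add: path_coeff_def insert_nth_def p_def)
      qed
      show "w (insert_nth (p + q) (a, last y) d) = (-1) ^ q * path_coeff w (insert_nth p a x') y"
      proof (cases "a = last x'")
        case False
        then show ?thesis
          unfolding ins coeff unfolding q_def using y by (intro move_horizontal_past_column) auto
      next
        case True
        \<comment> \<open>The appended vertex repeats the last one, so both paths are irregular and \<open>w\<close> vanishes on them.\<close>
        have "\<not> distinct_adj (?s @ map (Pair (last x')) (hd y # tl y) @ [(a, last (hd y # tl y))])"
          using True y by (simp add: distinct_adj_append_iff last_map)
        moreover have "\<not> distinct_adj (?s @ (last x', hd y) # map (Pair a) (hd y # tl y))"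
          using True by (simp add: distinct_adj_append_iff)
        ultimately show ?thesis
          unfolding ins coeff using support_distinct_adj by (metis mult_zero_right)
      qed
    qed simp
    finally show ?thesis by (simp add: sum_distrib_left)
  qed
  have "d \<notin> cartesian_product PX PY" using proj x' by (simp add: cartesian_product_def)
  moreover have "distinct_adj d"
    using x' x'_ne y by (simp add: d_def distinct_adj_row_then_column)
  ultimately have "0 = boundary_coeff (X \<times> Y) w d"
    using boundary_coeff_eq_0 by simp
  also have "\<dots> = (\<Sum>k\<le>p + q. (-1) ^ k * T k)"
    by (simp add: boundary_coeff_def T_def len)
  also have "\<dots> = (\<Sum>k<p + q. (-1) ^ k * T k) + (-1) ^ (p + q) * T (p + q)"
    by (simp add: lessThan_Suc_atMost[symmetric])
  also have "(\<Sum>k<p + q. (-1) ^ k * T k) = (\<Sum>k<p. (-1) ^ k * T k)"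
  proof (rule sum.mono_neutral_right)
    show "\<forall>k\<in>{..<p + q} - {..<p}. (-1) ^ k * T k = 0"
    proof
      fix k assume "k \<in> {..<p + q} - {..<p}"
      then show "(-1) ^ k * T k = 0" using column[of "k - p"] by auto
    qed
  qed auto
  also have "(-1) ^ (p + q) * T (p + q) = (-1) ^ p * (\<Sum>a\<in>X. path_coeff w (insert_nth p a x') y)"
    unfolding end_of_column by (simp add: power_add flip: power_mult_distrib)
  also have "(\<Sum>k<p. (-1) ^ k * T k) + \<dots> = boundary_coeff X (\<lambda>x. path_coeff w x y) x'"
    by (simp add: row boundary_coeff_def p_def lessThan_Suc_atMost[symmetric])
  finally show ?thesis by simp
qed

text \<open>
  Exchanging the factors turns a row followed by a column into a column followed by a row, so the
  matrices of \<open>w\<close> and of its transpose differ by the sign of a full rectangle of reflections. This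
  sign depends on the lengths only and does not affect invariance.
\<close>
lemma column_then_row:
  assumes "distinct_adj y" "y \<noteq> []" "distinct_adj (a # xs)"
  shows "w (s @ map (Pair a) y @ map (\<lambda>x. (x, last y)) xs) =
    (-1) ^ (length xs * (length y - 1)) * w (s @ row_then_column (a # xs) y)"
  using assms
proof (induction y arbitrary: s rule: induct_list012)
  case (2 b)
  then show ?case by (simp add: row_then_column_def)
next
  case (3 b b' ys)
  have "w (s @ map (Pair a) (b # b' # ys) @ map (\<lambda>x. (x, last (b # b' # ys))) xs) =
     (-1) ^ (length xs * length ys) * w (s @ (a, b) # row_then_column (a # xs) (b' # ys))"
    using "3.IH"(2)[of "s @ [(a, b)]"] "3.prems" by simp
  also have "w (s @ (a, b) # row_then_column (a # xs) (b' # ys)) =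
      (-1) ^ length xs * w (s @ row_then_column (a # xs) (b # b' # ys))"
    using move_vertical_past_row[of a xs b b' s] "3.prems" by (simp add: row_then_column_def)
  finally show ?case by (simp add: power_add)
qed simp

lemma path_coeff_swap:
  "path_coeff (\<lambda>z. w (map prod.swap z)) y x =
    (-1) ^ ((length x - 1) * (length y - 1)) * path_coeff w x y"
proof (cases "x \<noteq> [] \<and> y \<noteq> [] \<and> distinct_adj x \<and> distinct_adj y")
  case True
  have "map prod.swap (row_then_column y x) =
      map (Pair (hd x)) y @ map (\<lambda>a. (a, last y)) (tl x)"
    by (simp add: row_then_column_def)
  then show ?thesis
    using True column_then_row[of y "hd x" "tl x" "[]"] by (simp add: path_coeff_def)
next
  case False
  have "distinct_adj (map prod.swap z) \<longleftrightarrow> distinct_adj z" for z :: "('b \<times> 'a) list"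
    by (intro distinct_adj_map_iff) simp
  then have "path_coeff (\<lambda>z. w (map prod.swap z)) y x = 0"
    using False support_distinct_adj distinct_adj_row_then_column[of y x] unfolding path_coeff_def by metis
  moreover have "path_coeff w x y = 0"
    using False path_coeff_nonempty path_coeff_distinct_adj by blast
  ultimately show ?thesis by simp
qed

lemma swap_factors: "invariant_product_chain Y X PY PX r (\<lambda>z. w (map prod.swap z))"
proof
  have mem: "map prod.swap z \<in> cartesian_product PX PY \<longleftrightarrow> z \<in> cartesian_product PY PX" for z
  proof -
    have "distinct_adj (map prod.swap z) \<longleftrightarrow> distinct_adj z"
      by (intro distinct_adj_map_iff) simp
    then show ?thesis
      by (auto simp: cartesian_product_def step_like_def proj_X_def proj_Y_def successively_map comp_def
          disj_commute)
  qed
  show "w (map prod.swap z) \<noteq> 0 \<Longrightarrow> z \<in> cartesian_product PY PX \<and> length z = Suc r" for z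
    using support[of "map prod.swap z"] by (simp add: mem)
  fix d :: "('b \<times> 'a) list"
  assume d: "distinct_adj d" "length d = r" "d \<notin> cartesian_product PY PX"
  have "(\<Sum>e\<in>Y \<times> X. w (map prod.swap (insert_nth k e d))) =
      (\<Sum>e\<in>X \<times> Y. w (insert_nth k e (map prod.swap d)))" for k
    by (rule sum.reindex_bij_witness[of _ prod.swap prod.swap])
      (auto simp: insert_nth_def take_map drop_map)
  then have "boundary_coeff (Y \<times> X) (\<lambda>z. w (map prod.swap z)) d =
      boundary_coeff (X \<times> Y) w (map prod.swap d)"
    by (simp add: boundary_coeff_def)
  also have "\<dots> = 0"
    using d mem[of d] by (intro boundary_coeff_eq_0) (auto intro: distinct_adj_mapI)
  finally show "boundary_coeff (Y \<times> X) (\<lambda>z. w (map prod.swap z)) d = 0" .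
qed (use finite_X finite_Y PX PY Nil_PX Nil_PY in auto)

lemma row_boundary:
  assumes "distinct_adj y'" "y' \<notin> PY"
  shows "boundary_coeff Y (path_coeff w x) y' = 0"
proof -
  interpret swapped: invariant_product_chain Y X PY PX r "\<lambda>z. w (map prod.swap z)"
    by (rule swap_factors)
  let ?sign = "(-1) ^ ((length x - 1) * length y') :: 'k"
  have "0 = boundary_coeff Y (\<lambda>y. path_coeff (\<lambda>z. w (map prod.swap z)) y x) y'"
    using swapped.column_boundary[OF assms] by simp
  also have "\<dots> = ?sign * boundary_coeff Y (path_coeff w x) y'"
    by (simp add: boundary_coeff_def path_coeff_swap sum_distrib_left mult.left_commute)
  finally show ?thesis by simp
qed

text \<open>
  Invariance is a condition on chains of a single degree, so the matrix is split into the blocks of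
  bidegree \<open>(p, r - p)\<close>.
\<close>
definition graded_coeff :: "nat \<Rightarrow> 'a list \<Rightarrow> 'b list \<Rightarrow> 'k" where
  "graded_coeff p x y = (if length x = Suc p then path_coeff w x y else 0)"

lemma column_invariant: "(\<lambda>x. graded_coeff p x y) \<in> invariant_chains PX p"
proof -
  have "boundary_coeff X (\<lambda>x. graded_coeff p x y) x' = boundary_coeff X (\<lambda>x. path_coeff w x y) x'"
    if "length x' = p" for x'
    using that by (simp add: boundary_coeff_def graded_coeff_def)
  then show ?thesis
    unfolding invariant_chains_iff[OF finite_X PX Nil_PX]
    using column_boundary path_coeff_X by (auto simp: graded_coeff_def)
qed

lemma row_invariant: "graded_coeff p x \<in> invariant_chains PY (r - p)"
proof (cases "length x = Suc p")
  case True
  then have eq: "graded_coeff p x = path_coeff w x" by (auto simp: graded_coeff_def)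
  have "length y = Suc (r - p)" if "path_coeff w x y \<noteq> 0" for y
    using path_coeff_length[OF that] path_coeff_nonempty(2)[OF that] True
    by (cases y) auto
  then show ?thesis
    unfolding invariant_chains_iff[OF finite_Y PY Nil_PY] eq
    using row_boundary path_coeff_Y by blast
next
  case False
  then have "graded_coeff p x = 0" by (auto simp: graded_coeff_def)
  then show ?thesis
    using chain.subspace_0[OF subspace_invariant_chains[OF finite_Y PY Nil_PY]] by simp
qed

lemma graded_decomposition:
  "\<exists>(m::nat) u v. (\<forall>i<m. u i \<in> invariant_chains PX p \<and> v i \<in> invariant_chains PY (r - p)) \<and>
    (\<forall>x y. graded_coeff p x y = (\<Sum>i<m. u i x * v i y))"
proof (rule matrix_decomposition)
  have "{x. \<exists>y. graded_coeff p x y \<noteq> 0} \<subseteq> {x. set x \<subseteq> X \<and> length x = Suc p}"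
    using path_coeff_X PX by (fastforce simp: graded_coeff_def split: if_splits)
  then show "finite {x. \<exists>y. graded_coeff p x y \<noteq> 0}"
    using finite_lists_length_eq[OF finite_X] by (rule finite_subset)
qed (use subspace_invariant_chains[OF finite_X PX Nil_PX] subspace_invariant_chains[OF finite_Y PY Nil_PY]
    column_invariant row_invariant in auto)

lemma path_coeff_graded: "path_coeff w x y = (\<Sum>p\<le>r. graded_coeff p x y)"
proof (cases "path_coeff w x y = 0")
  case True
  then have "graded_coeff p x y = 0" for p by (simp add: graded_coeff_def)
  then show ?thesis using True by simp
next
  case False
  then have "length x - 1 \<in> {..r}" and *: "length x = Suc p \<longleftrightarrow> p = length x - 1" for p
    using path_coeff_length[OF False] path_coeff_nonempty[OF False] by (cases x; cases y; auto)+
  then show ?thesis by (simp add: graded_coeff_def *)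
qed

end

section \<open>Representation by cross products\<close>

theorem theorem7p15:
  fixes X :: "'a set" and Y :: "'b set"
    and PX :: "'a list set" and PY :: "'b list set"
    and r :: nat and w :: "('a \<times> 'b, 'k::field) chain"
  assumes "finite X" and "finite Y"
    and "regular_path_complex X PX" and "regular_path_complex Y PY"
    and "w \<in> invariant_chains (cartesian_product PX PY) r"
  shows "\<exists>(k::nat) (p::nat \<Rightarrow> nat) (q::nat \<Rightarrow> nat)
            (u::nat \<Rightarrow> ('a, 'k) chain) (v::nat \<Rightarrow> ('b, 'k) chain).
           (\<forall>i\<in>{1..k}. p i + q i = r \<and>
                        u i \<in> invariant_chains PX (p i) \<and>
                        v i \<in> invariant_chains PY (q i)) \<and>
           w = (\<Sum>i = 1..k. cross (u i) (v i))"
proof -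
  let ?PZ = "cartesian_product PX PY"
  have complexes: "PX \<subseteq> lists X" "PY \<subseteq> lists Y" "[] \<in> PX" "[] \<in> PY"
    using assms(3,4) by (auto simp: regular_path_complex_def path_complex_def)
  have PZ: "?PZ \<subseteq> lists (X \<times> Y)"
  proof
    fix z assume "z \<in> ?PZ"
    then have "fst ` set z \<subseteq> X" "snd ` set z \<subseteq> Y"
      using complexes by (fastforce simp: cartesian_product_def proj_X_def proj_Y_def in_lists_conv_set)+
    then show "z \<in> lists (X \<times> Y)" by force
  qed
  have Nil_PZ: "[] \<in> ?PZ"
    using complexes by (simp add: cartesian_product_def proj_X_def proj_Y_def)
  interpret invariant_product_chain X Y PX PY r w
    using assms(1,2,5) complexes invariant_chains_iff[OF _ PZ Nil_PZ, of w r]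
    by unfold_locales auto
  have "\<forall>p. \<exists>(m::nat) u v.
      (\<forall>i<m. u i \<in> invariant_chains PX p \<and> v i \<in> invariant_chains PY (r - p)) \<and>
      (\<forall>x y. graded_coeff p x y = (\<Sum>i<m. u i x * v i y))"
    using graded_decomposition by blast
  then have "\<exists>(m :: nat \<Rightarrow> nat) u v. \<forall>p.
      (\<forall>i<m p. u p i \<in> invariant_chains PX p \<and> v p i \<in> invariant_chains PY (r - p)) \<and>
      (\<forall>x y. graded_coeff p x y = (\<Sum>i<m p. u p i x * v p i y))"
    unfolding choice_iff .
  then obtain m :: "nat \<Rightarrow> nat" and u v where
    uv: "\<And>p i. i < m p \<Longrightarrow> u p i \<in> invariant_chains PX p \<and> v p i \<in> invariant_chains PY (r - p)"
    and graded: "\<And>p x y. graded_coeff p x y = (\<Sum>i<m p. u p i x * v p i y)"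
    by (elim exE) blast
  define I where "I = (SIGMA p:{..r}. {..<m p})"
  have "finite I" by (simp add: I_def)
  then obtain h where h: "bij_betw h {1..card I} I"
    using ex_bij_betw_nat_finite_1 by blast
  have "w = (\<Sum>(p, i)\<in>I. cross (u p i) (v p i))"
  proof
    fix z
    show "w z = (\<Sum>(p, i)\<in>I. cross (u p i) (v p i)) z"
    proof (cases "step_like z")
      case True
      have "w z = (-1) ^ elevation z * (\<Sum>p\<le>r. \<Sum>i<m p. u p i (proj_X z) * v p i (proj_Y z))"
        by (simp add: step_like_coeff[OF True] path_coeff_graded graded)
      also have "\<dots> = (\<Sum>p\<le>r. \<Sum>i<m p. cross (u p i) (v p i) z)"
        using True by (simp add: cross_def sum_distrib_left mult.assoc)
      also have "\<dots> = (\<Sum>(p, i)\<in>I. cross (u p i) (v p i)) z"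
        by (simp add: I_def sum.Sigma sum_fun_apply case_prod_unfold)
      finally show ?thesis .
    next
      case False
      then show ?thesis
        using support_step_like by (auto simp: sum_fun_apply cross_def case_prod_unfold)
    qed
  qed
  also have "\<dots> = (\<Sum>j = 1..card I. cross (u (fst (h j)) (snd (h j))) (v (fst (h j)) (snd (h j))))"
    using sum.reindex_bij_betw[OF h, of "\<lambda>(p, i). cross (u p i) (v p i)"]
    by (simp add: case_prod_unfold)
  finally have w: "w = \<dots>" .
  have "h j \<in> I" if "j \<in> {1..card I}" for j
    using h that by (auto simp: bij_betw_def)
  then have "\<forall>j\<in>{1..card I}. fst (h j) + (r - fst (h j)) = r \<and>
      u (fst (h j)) (snd (h j)) \<in> invariant_chains PX (fst (h j)) \<and>
      v (fst (h j)) (snd (h j)) \<in> invariant_chains PY (r - fst (h j))"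
    using uv by (force simp: I_def)
  with w show ?thesis
    by (intro exI[of _ "card I"] exI[of _ "\<lambda>j. fst (h j)"] exI[of _ "\<lambda>j. r - fst (h j)"]
        exI[of _ "\<lambda>j. u (fst (h j)) (snd (h j))"] exI[of _ "\<lambda>j. v (fst (h j)) (snd (h j))"]) blast
qed

end
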